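(* Let $m\ge2$ be an integer and let $\omega_m$ be the $m$-th multinacci number. The two-dimensional Lebesgue measure of $\mathcal{S}_{\omega_m}$ is zero.
   Context: Let $\mathbf p_k=\frac23(\cos(2\pi k/3),\sin(2\pi k/3))\in\mathbb{R}^2$, $k=0,1,2$. For $\lambda\in(0,1)$ let $f_i(\mathbf x)=\lambda\mathbf x+(1-\lambda)\mathbf p_i$, $i=0,1,2$. The invariant set $\mathcal{S}_\lambda$ is the unique non-empty compact set with $\mathcal{S}_\lambda=\bigcup_{i=0}^2 f_i(\mathcal{S}_\lambda)$. For $m\ge2$ the multinacci number $\omega_m$ is the unique positive root of $x^m+x^{m-1}+\cdots+x=1$. *)

theory Defs
  imports "HOL-Analysis.Analysis"
begin

definition vertex :: "nat \<Rightarrow> real^2" where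
  "vertex k = (2/3) *\<^sub>R vector [cos (2 * pi * real k / 3), sin (2 * pi * real k / 3)]"

definition ifs_map :: "real \<Rightarrow> nat \<Rightarrow> real^2 \<Rightarrow> real^2" where
  "ifs_map \<rho> i x = \<rho> *\<^sub>R x + (1 - \<rho>) *\<^sub>R vertex i"

definition is_invariant_set :: "real \<Rightarrow> (real^2) set \<Rightarrow> bool" where
  "is_invariant_set \<rho> S \<longleftrightarrow> S \<noteq> {} \<and> compact S \<and> S = (\<Union>i\<in>{0..2}. ifs_map \<rho> i ` S)"

(* Meaningful for 0 < \<rho> < 1 only; see ex1_invariant_set below. *)
definition invariant_set :: "real \<Rightarrow> (real^2) set" where
  "invariant_set \<rho> = (THE S. is_invariant_set \<rho> S)"

(* Meaningful for m \<ge> 1 only; see ex1_multinacci below. *)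
definition multinacci :: "nat \<Rightarrow> real" where
  "multinacci m = (THE x. 0 < x \<and> (\<Sum>k=1..m. x ^ k) = 1)"

lemma ex1_multinacci:
  assumes "1 \<le> m"
  shows "\<exists>!x::real. 0 < x \<and> (\<Sum>k=1..m. x ^ k) = 1"
proof -
  let ?f = "\<lambda>x::real. \<Sum>k=1..m. x ^ k"
  have mono: "?f x < ?f y" if "0 < x" "x < y" for x y
    using assms that by (intro sum_strict_mono) (auto intro: power_strict_mono)
  have "?f 0 = 0" by (simp add: power_0_left)
  moreover have "?f 1 \<ge> 1" using assms by simp
  moreover have "continuous_on {0..1} ?f" by (intro continuous_intros)
  ultimately obtain x where x: "0 \<le> x" "?f x = 1"
    using IVT'[of ?f 0 1 1] by auto
  with \<open>?f 0 = 0\<close> have "0 < x" by (cases "x = 0") auto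
  show ?thesis
  proof (intro ex1I[of _ x] conjI)
    fix y assume y: "0 < y \<and> ?f y = 1"
    show "y = x"
      using mono[of x y] mono[of y x] y x \<open>0 < x\<close> by (cases x y rule: linorder_cases) auto
  qed (use x \<open>0 < x\<close> in auto)
qed

lemma multinacci_root:
  assumes "1 \<le> m"
  shows "0 < multinacci m" and "(\<Sum>k=1..m. multinacci m ^ k) = 1"
  using theI'[OF ex1_multinacci[OF assms]] unfolding multinacci_def by auto

lemma multinacci_less_1:
  assumes "2 \<le> m"
  shows "multinacci m < 1"
proof (rule ccontr)
  assume "\<not> multinacci m < 1"
  then have "(\<Sum>k=1..m. multinacci m ^ k) \<ge> (\<Sum>k=1..m. 1)"
    by (intro sum_mono) (auto intro: one_le_power)
  with multinacci_root(2)[of m] assms show False by auto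
qed

lemma dist_ifs_map: "dist (ifs_map \<rho> i x) (ifs_map \<rho> i y) = \<bar>\<rho>\<bar> * dist x y"
  by (simp add: ifs_map_def dist_norm flip: scaleR_diff_right)

lemma inj_ifs_map: "\<rho> \<noteq> 0 \<Longrightarrow> inj (ifs_map \<rho> i)"
  by (auto simp: inj_def ifs_map_def)

lemma continuous_on_ifs_map: "continuous_on A (ifs_map \<rho> i)"
  unfolding ifs_map_def by (intro continuous_intros)

lemma invariant_set_subset:
  assumes \<rho>: "0 < \<rho>" "\<rho> < 1" and A: "is_invariant_set \<rho> A" and B: "is_invariant_set \<rho> B"
  shows "A \<subseteq> B"
proof -
  have B': "B \<noteq> {}" "compact B" "B = (\<Union>i\<in>{0..2}. ifs_map \<rho> i ` B)"
    and A': "A \<noteq> {}" "compact A" "A = (\<Union>i\<in>{0..2}. ifs_map \<rho> i ` A)"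
    using A B unfolding is_invariant_set_def by blast+
  obtain a where a: "a \<in> A" "\<And>x. x \<in> A \<Longrightarrow> infdist x B \<le> infdist a B"
    using continuous_attains_sup[OF A'(2,1) continuous_on_infdist[OF continuous_on_id]] by blast
  obtain i c where c: "i \<in> {0..2}" "c \<in> A" "a = ifs_map \<rho> i c"
    using a(1) A'(3) by blast
  obtain b where b: "b \<in> B" "infdist c B = dist c b"
    using infdist_attains_inf[OF compact_imp_closed[OF B'(2)] B'(1)] by metis
  have "ifs_map \<rho> i b \<in> B" using b(1) c(1) B'(3) by blast
  then have "infdist a B \<le> \<rho> * infdist c B"
    using \<rho> b(2) c(3) infdist_le[of "ifs_map \<rho> i b" B a] by (simp add: dist_ifs_map)
  also have "\<dots> \<le> \<rho> * infdist a B" using a(2)[OF c(2)] \<rho> by simp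
  finally have "(1 - \<rho>) * infdist a B \<le> 0" by (simp add: algebra_simps)
  then have "infdist a B \<le> 0" using \<rho> by (simp add: mult_le_0_iff)
  then have "infdist x B = 0" if "x \<in> A" for x
    using a(2)[OF that] infdist_nonneg[of x B] by linarith
  then show ?thesis
    using in_closed_iff_infdist_zero[OF compact_imp_closed[OF B'(2)] B'(1)] by blast
qed

lemma ex1_invariant_set:
  assumes \<rho>: "0 < \<rho>" "\<rho> < 1"
  shows "\<exists>!S. is_invariant_set \<rho> S"
proof -
  define F where "F S = (\<Union>i\<in>{0..2}. ifs_map \<rho> i ` S)" for S
  define R where "R = Max ((\<lambda>i. norm (vertex i)) ` {0..2})"
  define K where "K n = (F ^^ n) (cball 0 R)" for n
  have vR: "norm (vertex i) \<le> R" if "i \<in> {0..2}" for i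
    unfolding R_def using that by (intro Max_ge) auto
  have "0 \<le> R" using order_trans[OF norm_ge_zero vR[of 0]] by simp
  have mono: "F X \<subseteq> F Y" if "X \<subseteq> Y" for X Y using that unfolding F_def by blast
  have K0: "K 0 = cball 0 R" and KS: "K (Suc n) = F (K n)" for n by (simp_all add: K_def)
  have F0: "F (cball 0 R) \<subseteq> cball 0 R"
  proof -
    have "norm (ifs_map \<rho> i x) \<le> R" if "norm x \<le> R" "i \<in> {0..2}" for i x
    proof -
      have "norm (ifs_map \<rho> i x) \<le> \<rho> * norm x + (1 - \<rho>) * norm (vertex i)"
        unfolding ifs_map_def using \<rho> by (intro norm_triangle_le) simp
      also have "\<dots> \<le> \<rho> * R + (1 - \<rho>) * R"
        using \<rho> that vR by (intro add_mono mult_left_mono) auto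
      finally show ?thesis by (simp add: algebra_simps)
    qed
    then show ?thesis unfolding F_def by auto
  qed
  have dec: "K (Suc n) \<subseteq> K n" for n
  proof (induction n)
    case 0
    show ?case using F0 by (simp only: KS K0)
  next
    case (Suc n)
    show ?case using mono[OF Suc] by (simp only: KS)
  qed
  have decs: "K n \<subseteq> K m" if "m \<le> n" for m n
    using lift_Suc_antimono_le[of K, OF dec that] .
  have cpt: "compact (K n)" for n
    by (induction n)
      (auto simp: K0 KS F_def intro!: compact_UN compact_continuous_image continuous_on_ifs_map)
  have ne: "K n \<noteq> {}" for n
    by (induction n) (use \<open>0 \<le> R\<close> in \<open>auto simp: K0 KS F_def\<close>)
  define S where "S = (\<Inter>n. K n)"
  have "S \<noteq> {}" unfolding S_def by (rule compact_nest) (use cpt ne decs in auto)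
  moreover have "compact S" unfolding S_def by (rule compact_Inter) (use cpt in auto)
  moreover have "S = F S"
  proof
    show "F S \<subseteq> S"
    proof -
      have "F S \<subseteq> K n" for n
        using mono[of S "K n"] KS[of n] dec[of n] unfolding S_def by blast
      then show ?thesis unfolding S_def by blast
    qed
    show "S \<subseteq> F S"
    proof
      fix x assume "x \<in> S"
      then have "\<exists>i\<in>{0..2}. x \<in> ifs_map \<rho> i ` K n" for n
        using KS[of n] unfolding S_def F_def by blast
      then obtain i where i: "\<And>n. i n \<in> {0..2::nat} \<and> x \<in> ifs_map \<rho> (i n) ` K n" by metis
      have "range i \<subseteq> {0..2}" using i by blast
      then have "finite (range i)" by (rule finite_subset) simp
      then obtain j where j: "infinite {n. i n = i j}"
        using pigeonhole_infinite[of UNIV i] by auto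
      have all: "x \<in> ifs_map \<rho> (i j) ` K n" for n
      proof -
        obtain l where "l \<ge> n" "i l = i j"
          using j unfolding infinite_nat_iff_unbounded_le by auto
        then show ?thesis using i[of l] decs[of n l] by auto
      qed
      then obtain y where y: "x = ifs_map \<rho> (i j) y" by blast
      have "y \<in> K n" for n
        using all[of n] y inj_ifs_map[of \<rho> "i j"] \<rho> by (auto simp: inj_def)
      then show "x \<in> F S" using y i[of j] unfolding F_def S_def by blast
    qed
  qed
  ultimately have "is_invariant_set \<rho> S" unfolding is_invariant_set_def F_def by blast
  then show ?thesis using invariant_set_subset[OF \<rho>] by blast
qed

lemma is_invariant_set_invariant_set:
  assumes "0 < \<rho>" "\<rho> < 1"
  shows "is_invariant_set \<rho> (invariant_set \<rho>)"
  unfolding invariant_set_def by (rule theI'[OF ex1_invariant_set[OF assms]])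

end

theory Submission
  imports Defs
begin

text \<open>
  Write \<open>r = \<omega>\<^sub>m\<close>, \<open>S\<close> for the invariant set and \<open>\<mu>\<close> for its area. The identity
  \<open>S = f\<^sub>0 S \<union> f\<^sub>1 S \<union> f\<^sub>2 S\<close> by itself gives \<open>\<mu> \<le> 3 r\<^sup>2 \<mu>\<close>, which already forces \<open>\<mu> = 0\<close> when
  \<open>3 r\<^sup>2 < 1\<close>, that is for \<open>m \<ge> 3\<close>. For the golden ratio (\<open>m = 2\<close>) one has \<open>3 r\<^sup>2 > 1\<close>, and the
  overlaps of the three pieces must be counted.

  The equation \<open>r + \<dots> + r ^ m = 1\<close> makes the two compositions \<open>f\<^sub>i f\<^sub>j ^ m\<close> and \<open>f\<^sub>j f\<^sub>i ^ m\<close>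
  equal (lemma \<open>ifs_map_funpow_commute\<close>), so any two pieces share a copy of \<open>S\<close> scaled by
  \<open>r ^ (m + 1)\<close>. No point lies in all three pieces (lemma \<open>invariant_set_pieces_disjoint\<close>): in
  barycentric coordinates with respect to the vertices, the \<open>i\<close>-th coordinate is at least \<open>1 - r\<close>
  on \<open>f\<^sub>i S\<close>, and \<open>3 (1 - r) > 1\<close>. Inclusion-exclusion therefore gives
  \<open>\<mu> \<le> (3 r\<^sup>2 - 3 r ^ (2 m + 2)) \<mu>\<close>, and this factor is below \<open>1\<close> for every \<open>m \<ge> 2\<close>
  (lemma \<open>multinacci_contraction\<close>). As \<open>\<mu>\<close> is finite, it vanishes.
\<close>

section \<open>Estimates for the multinacci numbers\<close>

lemma multinacci_less_two_thirds:
  assumes "2 \<le> m"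
  shows "multinacci m < 2 / 3"
proof (rule ccontr)
  define r where "r = multinacci m"
  assume "\<not> multinacci m < 2 / 3"
  then have r: "2 / 3 \<le> r" by (simp add: r_def)
  have "(\<Sum>k=1..2. r ^ k) \<le> (\<Sum>k=1..m. r ^ k)"
    using assms r by (intro sum_mono2) auto
  then have "r + r ^ 2 \<le> 1"
    using multinacci_root(2)[of m] assms by (simp add: r_def numeral_2_eq_2)
  moreover have "(2 / 3) ^ 2 \<le> r ^ 2" using r by (intro power_mono) auto
  ultimately show False using r by (simp add: power2_eq_square)
qed

text \<open>
  For \<open>m = 2\<close> the relation \<open>r\<^sup>2 = 1 - r\<close> turns \<open>1 - 3 r\<^sup>2 + 3 r ^ 6\<close> into \<open>13 - 21 r\<close>, so the claim is
  that the inverse golden ratio lies below its Fibonacci approximant \<open>13 / 21\<close>.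
\<close>

lemma multinacci_contraction:
  assumes "2 \<le> m"
  shows "3 * multinacci m ^ 2 - 3 * multinacci m ^ (2 * m + 2) < 1"
proof -
  define r where "r = multinacci m"
  have r0: "0 < r" and sum: "(\<Sum>k=1..m. r ^ k) = 1"
    using multinacci_root[of m] assms by (simp_all add: r_def)
  have "3 * r ^ 2 - 3 * r ^ (2 * m + 2) < 1"
  proof (cases "m = 2")
    case True
    then have q: "r ^ 2 = 1 - r" using sum by (simp add: numeral_2_eq_2)
    have "r ^ 6 = (r ^ 2) ^ 3" by (simp flip: power_mult)
    also have "\<dots> = 5 - 8 * r"
      unfolding q using q by (simp add: power3_eq_cube power2_eq_square) algebra
    finally have r6: "r ^ 6 = 5 - 8 * r" .
    have "r < 13 / 21"
    proof (rule ccontr)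
      assume "\<not> r < 13 / 21"
      then have "13 / 21 \<le> r" by simp
      then have "(13 / 21) ^ 2 \<le> r ^ 2" by (intro power_mono) auto
      with q \<open>13 / 21 \<le> r\<close> show False by (simp add: power2_eq_square)
    qed
    with True q r6 show ?thesis by simp
  next
    case False
    then have "(\<Sum>k=1..3. r ^ k) \<le> (\<Sum>k=1..m. r ^ k)"
      using assms r0 by (intro sum_mono2) auto
    then have s3: "r + r ^ 2 + r ^ 3 \<le> 1"
      using sum by (simp add: numeral_3_eq_3 numeral_2_eq_2)
    have "3 * r ^ 2 < 1"
    proof (rule ccontr)
      assume "\<not> 3 * r ^ 2 < 1"
      then have sq: "1 / 3 \<le> r ^ 2" by simp
      \<comment> \<open>\<open>5 / 9\<close> is just below \<open>1 / sqrt 3\<close>, and \<open>5 / 9 + 1 / 3 + 5 / 27 > 1\<close>.\<close>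
      have "5 / 9 \<le> r"
      proof (rule ccontr)
        assume "\<not> 5 / 9 \<le> r"
        then have "r ^ 2 \<le> (5 / 9) ^ 2" using r0 by (intro power_mono) auto
        with sq show False by (simp add: power2_eq_square)
      qed
      moreover have "r * (1 / 3) \<le> r ^ 3"
        using mult_left_mono[OF sq, of r] r0 by (simp add: power3_eq_cube power2_eq_square)
      ultimately show False using s3 sq by simp
    qed
    moreover have "0 \<le> r ^ (2 * m + 2)" using r0 by simp
    ultimately show ?thesis by linarith
  qed
  then show ?thesis by (simp add: r_def)
qed

section \<open>Overlaps of the pieces\<close>

lemma funpow_ifs_map:
  "(ifs_map \<rho> i ^^ n) x = \<rho> ^ n *\<^sub>R x + (1 - \<rho> ^ n) *\<^sub>R vertex i"
proof (induction n)
  case (Suc n)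
  have "(ifs_map \<rho> i ^^ Suc n) x = ifs_map \<rho> i (\<rho> ^ n *\<^sub>R x + (1 - \<rho> ^ n) *\<^sub>R vertex i)"
    by (simp add: Suc)
  also have "\<dots> = \<rho> ^ Suc n *\<^sub>R x + (1 - \<rho> ^ Suc n) *\<^sub>R vertex i"
    by (simp add: ifs_map_def algebra_simps)
  finally show ?case .
qed simp

text \<open>
  The translation part of \<open>f\<^sub>i f\<^sub>j ^ n\<close> is \<open>(1 - \<rho>) p\<^sub>i + (\<rho> - \<rho> ^ (n + 1)) p\<^sub>j\<close>. The geometric sum
  gives \<open>\<rho> - \<rho> ^ (n + 1) = (1 - \<rho>) (\<rho> + \<dots> + \<rho> ^ n) = 1 - \<rho>\<close>, which makes it symmetric in \<open>i\<close> and \<open>j\<close>.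
\<close>

lemma ifs_map_funpow_eq:
  assumes "(\<Sum>k=1..n. \<rho> ^ k) = 1"
  shows "ifs_map \<rho> i ((ifs_map \<rho> j ^^ n) x) =
    \<rho> ^ (n + 1) *\<^sub>R x + (1 - \<rho>) *\<^sub>R (vertex i + vertex j)"
proof -
  have "\<rho> - \<rho> ^ (n + 1) = (1 - \<rho>) * (\<Sum>k=1..n. \<rho> ^ k)"
    by (induction n) (simp_all add: algebra_simps)
  then have "\<rho> * (1 - \<rho> ^ n) = 1 - \<rho>" using assms by (simp add: algebra_simps)
  then show ?thesis
    by (simp add: funpow_ifs_map ifs_map_def scaleR_add_right add.commute)
qed

lemma ifs_map_funpow_commute:
  assumes "(\<Sum>k=1..n. \<rho> ^ k) = 1"
  shows "ifs_map \<rho> i ((ifs_map \<rho> j ^^ n) x) = ifs_map \<rho> j ((ifs_map \<rho> i ^^ n) x)"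
  by (simp add: ifs_map_funpow_eq[OF assms] add.commute)

lemma measure_ifs_map_image:
  "measure lebesgue (ifs_map \<rho> i ` A) = \<rho> ^ 2 * measure lebesgue A"
proof -
  have "ifs_map \<rho> i = (\<lambda>x. \<rho> *\<^sub>R x + (1 - \<rho>) *\<^sub>R vertex i)"
    by (simp add: ifs_map_def fun_eq_iff)
  then show ?thesis by (simp add: measure_lebesgue_affine)
qed

lemma compact_ifs_map_image: "compact A \<Longrightarrow> compact (ifs_map \<rho> i ` A)"
  by (intro compact_continuous_image continuous_on_ifs_map)

lemma ifs_map_in_invariant_set:
  assumes "is_invariant_set \<rho> S" "i \<in> {0..2}" "x \<in> S"
  shows "ifs_map \<rho> i x \<in> S"
  using assms unfolding is_invariant_set_def by blast

lemma measure_overlap_ge: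
  assumes S: "is_invariant_set \<rho> S" and sum: "(\<Sum>k=1..n. \<rho> ^ k) = 1"
    and ij: "i \<in> {0..2}" "j \<in> {0..2}"
  shows "\<rho> ^ (2 * n + 2) * measure lebesgue S
    \<le> measure lebesgue (ifs_map \<rho> i ` S \<inter> ifs_map \<rho> j ` S)"
proof -
  let ?g = "\<lambda>x. \<rho> ^ (n + 1) *\<^sub>R x + (1 - \<rho>) *\<^sub>R (vertex i + vertex j)"
  have cpt: "compact S" using S by (simp add: is_invariant_set_def)
  have pow: "(ifs_map \<rho> k ^^ n) x \<in> S" if "k \<in> {0..2}" "x \<in> S" for k x
    by (induction n) (use that S in \<open>auto intro: ifs_map_in_invariant_set\<close>)
  have "?g ` S \<subseteq> ifs_map \<rho> i ` S \<inter> ifs_map \<rho> j ` S"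
  proof (intro image_subsetI IntI)
    fix x assume x: "x \<in> S"
    show "?g x \<in> ifs_map \<rho> i ` S"
      using pow[OF ij(2) x] ifs_map_funpow_eq[OF sum, of i j x] by (metis imageI)
    then show "?g x \<in> ifs_map \<rho> j ` S"
      using pow[OF ij(1) x] ifs_map_funpow_eq[OF sum, of i j x]
        ifs_map_funpow_commute[OF sum, of i j x] by (metis imageI)
  qed
  moreover have "?g ` S \<in> sets lebesgue"
    by (intro fmeasurableD lmeasurable_compact compact_continuous_image continuous_intros cpt)
  moreover have "ifs_map \<rho> i ` S \<inter> ifs_map \<rho> j ` S \<in> lmeasurable"
    by (intro lmeasurable_compact compact_Int compact_ifs_map_image cpt)
  ultimately have "measure lebesgue (?g ` S) \<le> measure lebesgue (ifs_map \<rho> i ` S \<inter> ifs_map \<rho> j ` S)"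
    by (rule measure_mono_fmeasurable)
  moreover have "measure lebesgue (?g ` S) = \<bar>\<rho> ^ (n + 1)\<bar> ^ 2 * measure lebesgue S"
    by (simp only: measure_lebesgue_affine) simp
  moreover have "\<bar>\<rho> ^ (n + 1)\<bar> ^ 2 = \<rho> ^ (2 * n + 2)"
    by (simp only: power2_abs flip: power_mult) (simp add: algebra_simps)
  ultimately show ?thesis by simp
qed

section \<open>No point lies in all three pieces\<close>

lemma vertex_values:
  "vertex 0 = vector [2 / 3, 0]"
  "vertex 1 = vector [- 1 / 3, sqrt 3 / 3]"
  "vertex 2 = vector [- 1 / 3, - sqrt 3 / 3]"
proof -
  have angle: "2 * pi * real 2 / 3 = pi / 3 + pi" by simp
  have "cos (2 * pi * real 2 / 3) = - 1 / 2" "sin (2 * pi * real 2 / 3) = - sqrt 3 / 2"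
    unfolding angle by (simp_all only: cos_periodic_pi sin_periodic_pi) (simp_all add: cos_60 sin_60)
  then show "vertex 2 = vector [- 1 / 3, - sqrt 3 / 3]"
    by (simp add: vertex_def vec_eq_iff forall_2)
qed (simp_all add: vertex_def vec_eq_iff forall_2 cos_120 sin_120)

lemma inner_real2: "x \<bullet> y = x $ 1 * y $ 1 + x $ 2 * (y $ 2)" for x y :: "real^2"
  by (simp add: inner_vec_def sum_2)

lemma inner_vertex:
  assumes "i \<in> {0..2}" "j \<in> {0..2}"
  shows "vertex i \<bullet> vertex j = (if i = j then 4 / 9 else - 2 / 9)"
proof -
  have "i = 0 \<or> i = 1 \<or> i = 2" "j = 0 \<or> j = 1 \<or> j = 2" using assms by auto
  then show ?thesis
    by (elim disjE; simp only: vertex_values[unfolded One_nat_def] vertex_values inner_real2 vector_2)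
      simp_all
qed

lemma sum_vertex: "vertex 0 + vertex 1 + vertex 2 = 0"
  by (simp add: vertex_values vec_eq_iff forall_2 del: One_nat_def)

text \<open>
  Up to an affine change, \<open>x \<bullet> p\<^sub>i\<close> is the \<open>i\<close>-th barycentric coordinate of \<open>x\<close>; the bound says that
  this coordinate is nonnegative on the invariant set, so that the set lies in the triangle spanned by
  the vertices. It is enough to look at a point of the set where the coordinate is smallest.
\<close>

lemma inner_vertex_ge:
  assumes \<rho>: "0 < \<rho>" "\<rho> < 1" and S: "is_invariant_set \<rho> S"
    and i: "i \<in> {0..2}" and x: "x \<in> S"
  shows "- 2 / 9 \<le> x \<bullet> vertex i"
proof -
  have S': "S \<noteq> {}" "compact S" "S = (\<Union>j\<in>{0..2}. ifs_map \<rho> j ` S)"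
    using S unfolding is_invariant_set_def by blast+
  have "continuous_on S (\<lambda>x. x \<bullet> vertex i)" by (intro continuous_intros)
  then obtain a where a: "a \<in> S" "\<And>y. y \<in> S \<Longrightarrow> a \<bullet> vertex i \<le> y \<bullet> vertex i"
    using continuous_attains_inf[OF S'(2,1)] by blast
  obtain j c where c: "j \<in> {0..2}" "c \<in> S" "a = ifs_map \<rho> j c"
    using a(1) S'(3) by blast
  have "\<rho> * (a \<bullet> vertex i) + (1 - \<rho>) * (- 2 / 9)
      \<le> \<rho> * (c \<bullet> vertex i) + (1 - \<rho>) * (vertex j \<bullet> vertex i)"
    using \<rho> a(2)[OF c(2)] by (intro add_mono mult_left_mono) (simp_all add: inner_vertex[OF c(1) i])
  also have "\<dots> = a \<bullet> vertex i" by (simp add: c(3) ifs_map_def inner_add_left)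
  finally have "(1 - \<rho>) * (- 2 / 9) \<le> (1 - \<rho>) * (a \<bullet> vertex i)" by (simp add: algebra_simps)
  then have "- 2 / 9 \<le> a \<bullet> vertex i" using \<rho> by (simp only: mult_le_cancel_left_pos)
  with a(2)[OF x] show ?thesis by simp
qed

lemma invariant_set_pieces_disjoint:
  assumes \<rho>: "0 < \<rho>" "\<rho> < 2 / 3" and S: "is_invariant_set \<rho> S"
  shows "ifs_map \<rho> 0 ` S \<inter> ifs_map \<rho> 1 ` S \<inter> ifs_map \<rho> 2 ` S = {}"
proof (rule ccontr)
  assume "\<not> ?thesis"
  then obtain y where y: "y \<in> ifs_map \<rho> 0 ` S" "y \<in> ifs_map \<rho> 1 ` S" "y \<in> ifs_map \<rho> 2 ` S"
    by blast
  \<comment> \<open>\<open>x \<bullet> p\<^sub>i\<close> is \<open>2 / 3\<close> times the \<open>i\<close>-th barycentric coordinate, minus \<open>2 / 9\<close>; so this bound says that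
    the coordinate is at least \<open>1 - \<rho>\<close>.\<close>
  have ge: "4 / 9 - 2 / 3 * \<rho> \<le> y \<bullet> vertex i" if i: "i \<in> {0..2}" and yi: "y \<in> ifs_map \<rho> i ` S" for i
  proof -
    obtain x where x: "x \<in> S" "y = ifs_map \<rho> i x" using yi by blast
    have "\<rho> * (- 2 / 9) \<le> \<rho> * (x \<bullet> vertex i)"
      using \<rho> inner_vertex_ge[OF _ _ S i x(1)] by (intro mult_left_mono) auto
    then show ?thesis
      by (simp add: x(2) ifs_map_def inner_add_left inner_vertex[OF i i] algebra_simps)
  qed
  have "y \<bullet> vertex 0 + y \<bullet> vertex 1 + y \<bullet> vertex 2 = 0"
    by (simp only: sum_vertex inner_zero_right flip: inner_add_right)
  moreover have "4 / 9 - 2 / 3 * \<rho> \<le> y \<bullet> vertex 0" "4 / 9 - 2 / 3 * \<rho> \<le> y \<bullet> vertex 1"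
    "4 / 9 - 2 / 3 * \<rho> \<le> y \<bullet> vertex 2"
    by (rule ge; use y in simp)+
  ultimately show False using \<rho> by linarith
qed

section \<open>The area vanishes\<close>

lemma measure_Un_three:
  assumes "A \<in> fmeasurable M" "B \<in> fmeasurable M" "C \<in> fmeasurable M" "A \<inter> B \<inter> C = {}"
  shows "measure M (A \<union> B \<union> C) = measure M A + measure M B + measure M C
    - measure M (A \<inter> B) - measure M (A \<inter> C) - measure M (B \<inter> C)"
proof -
  have "A \<inter> C \<inter> (B \<inter> C) = {}" using assms(4) by blast
  then have "measure M ((A \<union> B) \<inter> C) = measure M (A \<inter> C) + measure M (B \<inter> C)"
    using assms by (simp add: Int_Un_distrib2 measure_Un3 fmeasurable.Int)
  then show ?thesis using assms by (simp add: measure_Un3 fmeasurable.Un)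
qed

theorem proposition4p1:
  fixes m :: nat
  assumes "2 \<le> m"
  shows "emeasure lebesgue (invariant_set (multinacci m)) = 0"
proof -
  define r where "r = multinacci m"
  define S where "S = invariant_set r"
  define \<mu> where "\<mu> = measure lebesgue S"
  let ?f = "\<lambda>i. ifs_map r i ` S"
  have r0: "0 < r" and sum: "(\<Sum>k=1..m. r ^ k) = 1" and r1: "r < 2 / 3"
    using multinacci_root[of m] multinacci_less_two_thirds[OF assms] assms by (simp_all add: r_def)
  have inv: "is_invariant_set r S"
    unfolding S_def by (rule is_invariant_set_invariant_set) (use r0 r1 in auto)
  then have cpt: "compact S" and "S = (\<Union>i\<in>{0..2}. ?f i)"
    unfolding is_invariant_set_def by blast+
  moreover have "{0..2} = {0, 1, 2::nat}" by auto
  ultimately have S: "S = ?f 0 \<union> ?f 1 \<union> ?f 2" by auto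
  have fmeas: "?f i \<in> lmeasurable" for i
    by (intro lmeasurable_compact compact_ifs_map_image cpt)
  have "\<mu> = measure lebesgue (?f 0 \<union> ?f 1 \<union> ?f 2)" using S by (simp add: \<mu>_def)
  also have "\<dots> = measure lebesgue (?f 0) + measure lebesgue (?f 1) + measure lebesgue (?f 2)
      - measure lebesgue (?f 0 \<inter> ?f 1) - measure lebesgue (?f 0 \<inter> ?f 2)
      - measure lebesgue (?f 1 \<inter> ?f 2)"
    by (intro measure_Un_three fmeas invariant_set_pieces_disjoint[OF r0 r1 inv])
  also have "\<dots> \<le> 3 * (r ^ 2 * \<mu>) - 3 * (r ^ (2 * m + 2) * \<mu>)"
    using measure_overlap_ge[OF inv sum, of 0 1] measure_overlap_ge[OF inv sum, of 0 2]
      measure_overlap_ge[OF inv sum, of 1 2]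
    by (simp add: measure_ifs_map_image \<mu>_def)
  finally have "(1 - (3 * r ^ 2 - 3 * r ^ (2 * m + 2))) * \<mu> \<le> 0" by (simp add: algebra_simps)
  moreover have "0 < 1 - (3 * r ^ 2 - 3 * r ^ (2 * m + 2))"
    using multinacci_contraction[OF assms] by (simp add: r_def)
  moreover have "0 \<le> \<mu>" by (simp add: \<mu>_def)
  ultimately have "\<mu> = 0" by (simp only: mult_le_0_iff) linarith
  moreover have "emeasure lebesgue S = ennreal \<mu>"
    unfolding \<mu>_def using emeasure_eq_measure2[OF lmeasurable_compact[OF cpt]] .
  ultimately show ?thesis by (simp add: S_def r_def)
qed

end
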